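(* Let $\mathbb{K}$ be an algebraically closed field of characteristic zero, let $\Gamma$ be a finite, simple, connected, undirected graph without loops with vertex set $V=\{1,\dots,n\}$, $n\ge 2$, and let $\mathcal{A}\in\{\mathcal{A}_\Gamma,\mathcal{A}_{RW(\Gamma)}\}$ be one of the two evolution $\mathbb{K}$-algebras associated to $\Gamma$. Let $\mathcal{D}\le \operatorname{Aut}(\mathcal{A})$ be the diagonal subgroup. Then $\mathcal{D}\neq\{\mathrm{id}\}$ if and only if $\Gamma$ is bipartite.
   Context: For $i\in V$, $\mathcal{N}(i)=\{j\in V : \{i,j\}\text{ is an edge of }\Gamma\}$ and $d_i=|\mathcal{N}(i)|$. $\mathcal{A}_\Gamma$ is the $\mathbb{K}$-algebra with basis $B=\{e_1,\dots,e_n\}$ and bilinear product determined by $e_ie_j=0$ for $i\ne j$ and $e_i^2=\sum_{k\in\mathcal{N}(i)}e_k$. $\mathcal{A}_{RW(\Gamma)}$ is the $\mathbb{K}$-algebra with basis $B=\{e_1,\dots,e_n\}$ and bilinear product determined by $e_ie_j=0$ for $i\neq j$ and $e_i^2=\frac{1}{d_i}\sum_{k\in\mathcal{N}(i)}e_k$. $\operatorname{Aut}(\mathcal{A})$ is the group of bijective $\mathbb{K}$-linear maps $f:\mathcal{A}\to\mathcal{A}$ with $f(xy)=f(x)f(y)$ for all $x,y$. The diagonal subgroup $\mathcal{D}\le\operatorname{Aut}(\mathcal{A})$ is the set of $f\in\operatorname{Aut}(\mathcal{A})$ such that for every $i\in V$, $f(e_i)=t_{ii}e_i$ for some $t_{ii}\in\mathbb{K}^*$.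 *)

theory Defs
  imports
    "HOL-Analysis.Cartesian_Space"
    "HOL-Computational_Algebra.Polynomial"
    "Graph_Theory.Graph_Theory"
begin

text \<open>
  Finite simple undirected graphs are those of \<^locale>\<open>pair_graph\<close>: the edge \<open>{i, j}\<close> is
  represented by the two arcs \<open>(i, j)\<close> and \<open>(j, i)\<close>. The vertex set is a whole finite type
  \<open>'v\<close>, so that the \<open>n\<close>-dimensional space with basis indexed by the vertices is
  \<open>'k ^ 'v\<close>, with \<open>e\<^sub>i\<close> being \<open>axis i 1\<close>.
\<close>

definition neighbours :: "'v pair_pre_digraph \<Rightarrow> 'v \<Rightarrow> 'v set" where
  "neighbours G i = {j. (i, j) \<in> parcs G}"

definition bipartite :: "'v pair_pre_digraph \<Rightarrow> bool" where
  "bipartite G \<longleftrightarrow> (\<exists>U W. U \<union> W = pverts G \<and> U \<inter> W = {} \<and>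
     (\<forall>(i, j) \<in> parcs G. i \<in> U \<and> j \<in> W \<or> i \<in> W \<and> j \<in> U))"

abbreviation evec :: "'v \<Rightarrow> 'k::field ^ 'v::finite" where
  "evec i \<equiv> axis i 1"

text \<open>
  The bilinear extension of \<open>e\<^sub>i e\<^sub>j = 0\<close> for \<open>i \<noteq> j\<close> and \<open>e\<^sub>i\<^sup>2 = s i\<close>.
\<close>

definition evolution_mult ::
    "('v \<Rightarrow> 'k ^ 'v) \<Rightarrow> 'k ^ 'v \<Rightarrow> 'k ^ 'v \<Rightarrow> 'k::field ^ 'v::finite" where
  "evolution_mult s x y = (\<Sum>i\<in>UNIV. (x $ i * y $ i) *s s i)"

lemma evolution_mult_evec:
  "evolution_mult s (evec i) (evec j) = (if i = j then s i else 0)"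
proof -
  have "evolution_mult s (evec i) (evec j) =
      (\<Sum>k\<in>UNIV. if k = i then (if i = j then s i else 0) else 0)"
    unfolding evolution_mult_def by (rule sum.cong) (auto simp: axis_def)
  then show ?thesis by simp
qed

lemma linear_evolution_mult_right: "Vector_Spaces.linear (*s) (*s) (evolution_mult s x)"
  by unfold_locales
    (simp_all add: evolution_mult_def algebra_simps vector_sadd_rdistrib sum.distrib
      vec.scale_sum_right)

lemma linear_evolution_mult_left:
  "Vector_Spaces.linear (*s) (*s) (\<lambda>x. evolution_mult s x y)"
  by unfold_locales
    (simp_all add: evolution_mult_def algebra_simps vector_sadd_rdistrib sum.distrib
      vec.scale_sum_right)

definition graph_mult ::
    "'v pair_pre_digraph \<Rightarrow> 'k ^ 'v \<Rightarrow> 'k ^ 'v \<Rightarrow> 'k::field ^ 'v::finite" where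
  "graph_mult G = evolution_mult (\<lambda>i. \<Sum>k\<in>neighbours G i. evec k)"

definition random_walk_mult ::
    "'v pair_pre_digraph \<Rightarrow> 'k ^ 'v \<Rightarrow> 'k ^ 'v \<Rightarrow> 'k::field ^ 'v::finite" where
  "random_walk_mult G =
     evolution_mult (\<lambda>i. (1 / of_nat (card (neighbours G i))) *s (\<Sum>k\<in>neighbours G i. evec k))"

text \<open>
  The algebra is given by its product \<open>m\<close> on \<open>'k ^ 'v\<close>. Automorphism groups are
  represented by their underlying sets of maps, under composition.
\<close>

definition alg_Aut ::
    "('k ^ 'v \<Rightarrow> 'k ^ 'v \<Rightarrow> 'k ^ 'v) \<Rightarrow> ('k::field ^ 'v::finite \<Rightarrow> 'k ^ 'v) set" where
  "alg_Aut m =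
     {f. bij f \<and> Vector_Spaces.linear (*s) (*s) f \<and> (\<forall>x y. f (m x y) = m (f x) (f y))}"

definition diagonal_subgroup ::
    "('k ^ 'v \<Rightarrow> 'k ^ 'v \<Rightarrow> 'k ^ 'v) \<Rightarrow> ('k::field ^ 'v::finite \<Rightarrow> 'k ^ 'v) set" where
  "diagonal_subgroup m = {f \<in> alg_Aut m. \<forall>i. \<exists>t. t \<noteq> 0 \<and> f (evec i) = t *s evec i}"

lemma id_in_diagonal_subgroup: "id \<in> diagonal_subgroup m"
  by (auto simp: diagonal_subgroup_def alg_Aut_def vec.linear_id intro!: exI[of _ 1])

end

theory Submission
  imports Defs
begin

text \<open>
  A diagonal map \<open>e\<^sub>i \<mapsto> t\<^sub>i e\<^sub>i\<close> is an automorphism iff \<open>t\<^sub>k = t\<^sub>i\<^sup>2\<close> whenever \<open>e\<^sub>k\<close> occurs in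
  \<open>e\<^sub>i\<^sup>2\<close>, i.e. along every arc \<open>(i, k)\<close>. Reading an edge in both directions gives
  \<open>t\<^sub>i = t\<^sub>i\<^sup>4\<close>. So if \<open>t\<^sub>i = w\<close> at one vertex of a connected graph, then \<open>t\<close> alternates along
  edges between \<open>w\<close> and \<open>w\<^sup>2\<close>, and if \<open>w \<noteq> 1\<close> these are distinct and 2-colour the graph.
  Conversely, a 2-colouring with a primitive cube root of unity \<open>w\<close> and its square defines a
  non-trivial diagonal automorphism.
\<close>

definition diag_map :: "('v \<Rightarrow> 'k) \<Rightarrow> 'k ^ 'v \<Rightarrow> 'k::field ^ 'v::finite" where
  "diag_map t x = (\<chi> i. t i * x $ i)"

lemma linear_diag_map: "Vector_Spaces.linear (*s) (*s) (diag_map t)"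
  by unfold_locales (simp_all add: diag_map_def vec_eq_iff algebra_simps)

lemma diag_map_evec: "diag_map t (evec i) = t i *s evec i"
  by (simp add: diag_map_def vec_eq_iff axis_def)

lemma diag_map_eq_id_iff: "diag_map t = id \<longleftrightarrow> (\<forall>i. t i = 1)"
proof
  assume "diag_map t = id"
  then have "t i *s evec i = evec i" for i
    by (metis diag_map_evec id_apply)
  then show "\<forall>i. t i = 1"
    by (metis axis_nth mult.right_neutral vector_smult_component)
qed (auto simp: diag_map_def vec_eq_iff)

lemma bij_diag_map:
  assumes "\<And>i. t i \<noteq> 0"
  shows "bij (diag_map t)"
proof (rule o_bij)
  show "diag_map (\<lambda>i. inverse (t i)) \<circ> diag_map t = id"
    and "diag_map t \<circ> diag_map (\<lambda>i. inverse (t i)) = id"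
    using assms by (auto simp: diag_map_def vec_eq_iff)
qed

text \<open>A linear map is determined by its values on the basis, so choosing one scalar per vertex
  recovers all of \<open>f\<close>.\<close>

lemma diagonal_subgroup_obtain_diag_map:
  assumes "f \<in> diagonal_subgroup m"
  obtains t where "\<And>i. t i \<noteq> 0" and "f = diag_map t"
proof -
  from assms obtain t where t: "\<And>i. t i \<noteq> 0" "\<And>i. f (evec i) = t i *s evec i"
    unfolding diagonal_subgroup_def by (auto dest!: choice)
  interpret f: Vector_Spaces.linear "(*s)" "(*s)" f
    using assms by (simp add: diagonal_subgroup_def alg_Aut_def)
  interpret d: Vector_Spaces.linear "(*s)" "(*s)" "diag_map t"
    by (rule linear_diag_map)
  have "f x = diag_map t x" for x
  proof -
    have "f (\<Sum>i\<in>UNIV. x $ i *s evec i) = diag_map t (\<Sum>i\<in>UNIV. x $ i *s evec i)"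
      by (simp only: f.sum d.sum f.scale d.scale t(2) diag_map_evec)
    then show ?thesis by (simp only: basis_expansion)
  qed
  then have "f = diag_map t" by (rule ext)
  with t(1) show ?thesis by (rule that)
qed

text \<open>Distinct basis vectors multiply to zero before and after scaling, so only the squares
  \<open>s i\<close> matter; comparing their \<open>k\<close>-th coordinates, a nonzero coefficient
  can be cancelled.\<close>

lemma diag_map_mem_diagonal_subgroup_iff:
  assumes nz: "\<And>i. t i \<noteq> 0"
  shows "diag_map t \<in> diagonal_subgroup (evolution_mult s) \<longleftrightarrow>
    (\<forall>i k. s i $ k \<noteq> 0 \<longrightarrow> t k = (t i)\<^sup>2)"
proof
  assume mem: "diag_map t \<in> diagonal_subgroup (evolution_mult s)"
  have "t k * s i $ k = (t i)\<^sup>2 * s i $ k" for i k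
  proof -
    have "diag_map t (evolution_mult s (evec i) (evec i)) =
        evolution_mult s (diag_map t (evec i)) (diag_map t (evec i))"
      using mem by (simp add: diagonal_subgroup_def alg_Aut_def)
    also have "\<dots> = (t i)\<^sup>2 *s evolution_mult s (evec i) (evec i)"
      by (simp add: diag_map_evec evolution_mult_def vec.scale_sum_right power2_eq_square mult_ac)
    finally have "diag_map t (s i) = (t i)\<^sup>2 *s s i"
      by (simp add: evolution_mult_evec)
    then show ?thesis by (simp add: diag_map_def vec_eq_iff)
  qed
  then show "\<forall>i k. s i $ k \<noteq> 0 \<longrightarrow> t k = (t i)\<^sup>2" by auto
next
  assume "\<forall>i k. s i $ k \<noteq> 0 \<longrightarrow> t k = (t i)\<^sup>2"
  then have eq: "t k * s i $ k = (t i)\<^sup>2 * s i $ k" for i k by auto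
  have "diag_map t (evolution_mult s x y) = evolution_mult s (diag_map t x) (diag_map t y)" for x y
  proof -
    \<comment> \<open>The two products agree summand by summand: this is \<open>eq\<close>
      multiplied by \<open>x $ i * y $ i\<close>.\<close>
    have "t k * (x $ i * y $ i * s i $ k) = t i * x $ i * (t i * y $ i) * s i $ k" for i k
      using arg_cong[OF eq, of "\<lambda>a. x $ i * y $ i * a" k i]
      by (simp add: power2_eq_square mult_ac)
    then show ?thesis
      by (simp only: evolution_mult_def diag_map_def vec_eq_iff sum_component
        vector_smult_component vec_lambda_beta sum_distrib_left simp_thms)
  qed
  then show "diag_map t \<in> diagonal_subgroup (evolution_mult s)"
    using nz bij_diag_map[of t] linear_diag_map[of t]
    by (auto simp: diagonal_subgroup_def alg_Aut_def diag_map_evec)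
qed

lemma diagonal_subgroup_nontrivial_iff:
  fixes s :: "'v::finite \<Rightarrow> 'k::field ^ 'v"
  shows "diagonal_subgroup (evolution_mult s) \<noteq> {id} \<longleftrightarrow>
    (\<exists>t :: 'v \<Rightarrow> 'k. (\<forall>i. t i \<noteq> 0) \<and> (\<forall>i k. s i $ k \<noteq> 0 \<longrightarrow> t k = (t i)\<^sup>2) \<and> (\<exists>i. t i \<noteq> 1))"
  (is "?L \<longleftrightarrow> ?R")
proof
  assume ?L
  then obtain f where f: "f \<in> diagonal_subgroup (evolution_mult s)" "f \<noteq> id"
    using id_in_diagonal_subgroup[of "evolution_mult s"] by blast
  from f(1) obtain t where "\<And>i. t i \<noteq> 0" and "f = diag_map t"
    by (rule diagonal_subgroup_obtain_diag_map) blast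
  with f show ?R
    by (metis diag_map_mem_diagonal_subgroup_iff diag_map_eq_id_iff)
next
  assume ?R
  then obtain t :: "'v \<Rightarrow> 'k" where "\<forall>i. t i \<noteq> 0" "\<forall>i k. s i $ k \<noteq> 0 \<longrightarrow> t k = (t i)\<^sup>2" "\<exists>i. t i \<noteq> 1"
    by blast
  then have "diag_map t \<in> diagonal_subgroup (evolution_mult s)" "diag_map t \<noteq> id"
    by (simp_all add: diag_map_mem_diagonal_subgroup_iff diag_map_eq_id_iff)
  then show ?L by blast
qed

lemma sum_evec_nth: "(\<Sum>k\<in>A. evec k :: 'k::field ^ 'v::finite) $ j = (if j \<in> A then 1 else 0)"
  by (simp add: axis_def if_distrib cong: if_cong)

text \<open>The criterion on \<open>t\<close> sees only the support of the squares, so both algebras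
  can be treated at once. In characteristic zero the factor \<open>1 / d_i\<close> does not vanish
  at a vertex with a neighbour.\<close>

lemma graph_algebra_obtain_squares:
  fixes G :: "'v::finite pair_pre_digraph"
    and m :: "'k::field_char_0 ^ 'v \<Rightarrow> 'k ^ 'v \<Rightarrow> 'k ^ 'v"
  assumes "m \<in> {graph_mult G, random_walk_mult G}"
  obtains s where "m = evolution_mult s" and "\<And>i k. s i $ k \<noteq> 0 \<longleftrightarrow> (i, k) \<in> parcs G"
proof -
  have card: "card (neighbours G i) \<noteq> 0" if "(i, k) \<in> parcs G" for i k
    using that by (auto simp: neighbours_def)
  from assms show thesis
  proof (elim insertE emptyE)
    assume "m = graph_mult G"
    then show thesis unfolding graph_mult_def
      by (rule that) (simp add: sum_evec_nth neighbours_def del: sum_component)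
  next
    assume "m = random_walk_mult G"
    then show thesis unfolding random_walk_mult_def
      by (rule that) (use card in \<open>auto simp: sum_evec_nth neighbours_def simp del: sum_component\<close>)
  qed
qed

text \<open>Connectedness means strong connectedness of the symmetric closure; the arcs of
  \<open>G\<close> are already symmetric, so every vertex is reached along arcs of \<open>G\<close>
  itself.\<close>

lemma (in pair_graph) connected_parcs_induct:
  assumes "Digraph_Component.connected (with_proj G)" and "u \<in> pverts G" and "v \<in> pverts G"
    and "P u" and step: "\<And>x y. (x, y) \<in> parcs G \<Longrightarrow> P x \<Longrightarrow> P y"
  shows "P v"
proof -
  have "u \<rightarrow>\<^sup>*\<^bsub>with_proj (mk_symmetric G)\<^esub> v"
    using assms by (auto simp: connected_def elim!: strongly_connectedE)
  then have "u \<rightarrow>\<^sup>*\<^bsub>with_proj G\<^esub> v"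
    using reachable_mk_symmetric_eq sym_arcs by blast
  then show ?thesis
    by (induction rule: reachable_induct) (auto intro: assms step)
qed

lemma ex_primitive_cube_root:
  obtains w :: "'k::{alg_closed_field, field_char_0}" where "w \<noteq> 0" "w \<noteq> 1" "w ^ 4 = w"
proof -
  \<comment> \<open>A root of \<open>1 + X + X^2\<close> is not 1, since 3 is nonzero in
    characteristic zero.\<close>
  obtain w :: 'k where "poly [:1, 1, 1:] w = 0"
    using alg_closed_imp_poly_has_root[of "[:1, 1, 1 :: 'k:]"] by auto
  then have w: "1 + w + w\<^sup>2 = 0"
    by (simp add: algebra_simps power2_eq_square)
  have "w ^ 4 - w = (1 + w + w\<^sup>2) * (w\<^sup>2 - w)"
    by (simp add: algebra_simps power_numeral_reduce)
  then show thesis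
    using w by (intro that[of w]) auto
qed

lemma bipartite_obtain_squaring:
  assumes "bipartite G"
  obtains t :: "'v \<Rightarrow> 'k::{alg_closed_field, field_char_0}"
    where "\<And>i. t i \<noteq> 0" "\<And>i k. (i, k) \<in> parcs G \<Longrightarrow> t k = (t i)\<^sup>2" "\<And>i. t i \<noteq> 1"
proof -
  obtain w :: 'k where w: "w \<noteq> 0" "w \<noteq> 1" "w ^ 4 = w"
    by (rule ex_primitive_cube_root)
  \<comment> \<open>Otherwise \<open>w = w ^ 4 = 1\<close>.\<close>
  from w have "w\<^sup>2 \<noteq> 1"
    by (auto simp: power4_eq_xxxx power2_eq_square)
  from assms obtain U W where UW: "U \<inter> W = {}"
      "\<forall>(i, j) \<in> parcs G. i \<in> U \<and> j \<in> W \<or> i \<in> W \<and> j \<in> U"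
    unfolding bipartite_def by auto
  show thesis
  proof (rule that)
    let ?t = "\<lambda>i. if i \<in> U then w else w\<^sup>2"
    show "?t k = (?t i)\<^sup>2" if "(i, k) \<in> parcs G" for i k
      \<comment> \<open>Leaving \<open>U\<close> squares \<open>w\<close>; returning to
        \<open>U\<close> uses \<open>w ^ 4 = w\<close>.\<close>
      using UW bspec[OF UW(2) that] w(3) by (auto simp flip: power_mult)
  qed (use w \<open>w\<^sup>2 \<noteq> 1\<close> in auto)
qed

lemma (in pair_graph) squaring_imp_bipartite:
  fixes t :: "'a \<Rightarrow> 'k::field"
  assumes con: "Digraph_Component.connected (with_proj G)"
    and sq: "\<And>i k. (i, k) \<in> parcs G \<Longrightarrow> t k = (t i)\<^sup>2"
    and v: "v \<in> pverts G" "t v \<noteq> 0" "t v \<noteq> 1"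
  shows "bipartite G"
proof -
  define w where "w = t v"
  have "w \<noteq> w\<^sup>2"
    using v by (simp add: w_def power2_eq_square)
  have fourth: "(t i) ^ 4 = t i" if "(i, k) \<in> parcs G" for i k
  proof -
    have "(k, i) \<in> parcs G"
      using that pair_sym_arcs by (auto simp: symmetric_def dest: symD)
    with sq[OF that] sq show ?thesis
      by (metis mult_2 numeral_Bit0 power2_eq_square power_add)
  qed
  have two: "t i = w \<or> t i = w\<^sup>2 \<and> w ^ 4 = w" if "i \<in> pverts G" for i
    using con v(1) that
  proof (rule connected_parcs_induct)
    show "t v = w \<or> t v = w\<^sup>2 \<and> w ^ 4 = w" by (simp add: w_def)
  next
    fix x y assume xy: "(x, y) \<in> parcs G" and "t x = w \<or> t x = w\<^sup>2 \<and> w ^ 4 = w"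
    then show "t y = w \<or> t y = w\<^sup>2 \<and> w ^ 4 = w"
      using sq[OF xy] fourth[OF xy] by (auto simp flip: power_mult)
  qed
  have "i \<in> pverts G \<and> j \<in> pverts G \<and> (t i = w \<longleftrightarrow> t j \<noteq> w)" if "(i, j) \<in> parcs G" for i j
  proof -
    have "i \<in> pverts G" "j \<in> pverts G"
      using that in_arcsD1 in_arcsD2 by auto
    then show ?thesis
      using two[of i] sq[OF that] \<open>w \<noteq> w\<^sup>2\<close> by (auto simp flip: power_mult)
  qed
  then show ?thesis
    unfolding bipartite_def
    by (intro exI[of _ "{i \<in> pverts G. t i = w}"] exI[of _ "{i \<in> pverts G. t i \<noteq> w}"]) auto
qed

theorem theorem2p9:
  fixes G :: "'v::finite pair_pre_digraph"
    and m :: "'k::{alg_closed_field, field_char_0} ^ 'v \<Rightarrow> 'k ^ 'v \<Rightarrow> 'k ^ 'v"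
  assumes "pair_graph G"
    and "pverts G = UNIV"
    and "CARD('v) \<ge> 2"
    and "Digraph_Component.connected (with_proj G)"
    and "m \<in> {graph_mult G, random_walk_mult G}"
  shows "diagonal_subgroup m \<noteq> {id} \<longleftrightarrow> bipartite G"
proof -
  interpret pair_graph G by fact
  from assms(5) obtain s where m: "m = evolution_mult s"
    and s: "\<And>i k. s i $ k \<noteq> 0 \<longleftrightarrow> (i, k) \<in> parcs G"
    by (rule graph_algebra_obtain_squares) blast
  have "diagonal_subgroup m \<noteq> {id} \<longleftrightarrow> (\<exists>t :: 'v \<Rightarrow> 'k.
      (\<forall>i. t i \<noteq> 0) \<and> (\<forall>i k. (i, k) \<in> parcs G \<longrightarrow> t k = (t i)\<^sup>2) \<and> (\<exists>i. t i \<noteq> 1))"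
    unfolding m by (simp only: diagonal_subgroup_nontrivial_iff s)
  also have "\<dots> \<longleftrightarrow> bipartite G"
  proof
    assume "bipartite G"
    then obtain t :: "'v \<Rightarrow> 'k"
      where "\<And>i. t i \<noteq> 0" "\<And>i k. (i, k) \<in> parcs G \<Longrightarrow> t k = (t i)\<^sup>2" "\<And>i. t i \<noteq> 1"
      by (rule bipartite_obtain_squaring) blast
    then show "\<exists>t :: 'v \<Rightarrow> 'k. (\<forall>i. t i \<noteq> 0) \<and>
        (\<forall>i k. (i, k) \<in> parcs G \<longrightarrow> t k = (t i)\<^sup>2) \<and> (\<exists>i. t i \<noteq> 1)"
      by blast
  \<comment> \<open>Any index with \<open>t i\<close> different from 1 serves as the base vertex,
    since all of the type is the vertex set.\<close>
  qed (use assms(2,4) squaring_imp_bipartite in blast)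
  finally show ?thesis .
qed

end
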